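(* Let $\mathbf{F}(\mathbf{x}) = A\mathbf{x}$ be a vector field on $\mathbb{R}^n$, where $A$ is a real $n\times n$ matrix. Then every strictly orthogonal Helmholtz--Hodge decomposition of $\mathbf{F}$ (on $\mathbb{R}^n$) is of the form $$A\mathbf{x} = -P\mathbf{x} + H\mathbf{x}$$ (that is, $\nabla V(\mathbf{x}) = P\mathbf{x}$ and $\mathbf{u}(\mathbf{x}) = H\mathbf{x}$ for all $\mathbf{x}$), where $P$ is a real symmetric $n \times n$ matrix with $\mathrm{tr}(P) = -\mathrm{tr}(A)$ satisfying $$2P^2 + A^T P + PA = O,$$ and $H = A + P$. Conversely, if a real symmetric $n\times n$ matrix $P$ with $\mathrm{tr}(P) = -\mathrm{tr}(A)$ satisfies $2P^2 + A^TP + PA = O$, then $A = -P + H$, where $H = A + P$, gives a strictly orthogonal Helmholtz--Hodge decomposition $A\mathbf{x} = -P\mathbf{x} + H\mathbf{x}$ of $\mathbf{F}$.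
   Context: A Helmholtz--Hodge decomposition (HHD) of a vector field $\mathbf{F}$ on a domain $\Omega\subset\mathbb{R}^n$ is a decomposition $\mathbf{F} = -\nabla V + \mathbf{u}$, where $V:\Omega\to\mathbb{R}$ is a $C^3$ function and $\mathbf{u}$ is a vector field on $\Omega$ with $\nabla\cdot\mathbf{u} = 0$. Here all HHDs are defined on $\Omega=\mathbb{R}^n$. The HHD is strictly orthogonal on $\Omega$ if $\mathbf{u}(\mathbf{x})\cdot\nabla V(\mathbf{x}) = 0$ for all $\mathbf{x}\in\Omega$. $O$ denotes the zero matrix. *)

theory Defs
  imports "HOL-Analysis.Analysis"
begin

text \<open>
  Fields and potentials are total functions on \<open>real ^ 'n\<close>. All notions below use \<open>at x\<close>, so on an
  open set \<open>\<Omega>\<close> they only depend on the values on \<open>\<Omega>\<close>.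
\<close>

definition partial :: "'n::finite \<Rightarrow> (real ^ 'n \<Rightarrow> real) \<Rightarrow> real ^ 'n \<Rightarrow> real" where
  "partial i f x = frechet_derivative f (at x) (axis i 1)"

definition gradient :: "(real ^ 'n::finite \<Rightarrow> real) \<Rightarrow> real ^ 'n \<Rightarrow> real ^ 'n" where
  "gradient f x = (\<chi> i. partial i f x)"

definition divergence :: "(real ^ 'n::finite \<Rightarrow> real ^ 'n) \<Rightarrow> real ^ 'n \<Rightarrow> real" where
  "divergence u x = (\<Sum>i\<in>UNIV. partial i (\<lambda>y. u y $ i) x)"

primrec Ck_on :: "nat \<Rightarrow> (real ^ 'n::finite) set \<Rightarrow> (real ^ 'n \<Rightarrow> real) \<Rightarrow> bool" where
  "Ck_on 0 \<Omega> f \<longleftrightarrow> continuous_on \<Omega> f"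
| "Ck_on (Suc k) \<Omega> f \<longleftrightarrow>
     (\<forall>x\<in>\<Omega>. f differentiable (at x)) \<and> (\<forall>i. Ck_on k \<Omega> (partial i f))"

text \<open>
  Differentiability of \<open>u\<close> is what makes its divergence meaningful, since
  \<^const>\<open>frechet_derivative\<close> is unspecified at points of non-differentiability. It is automatic when
  \<open>F\<close> is differentiable, because \<open>u = F + gradient V\<close> on \<open>\<Omega>\<close> and \<open>V\<close> is three times continuously
  differentiable.
\<close>

definition helmholtz_hodge ::
  "(real ^ 'n::finite) set \<Rightarrow> (real ^ 'n \<Rightarrow> real ^ 'n) \<Rightarrow> (real ^ 'n \<Rightarrow> real) \<Rightarrow> (real ^ 'n \<Rightarrow> real ^ 'n) \<Rightarrow> bool"
  where
  "helmholtz_hodge \<Omega> F V u \<longleftrightarrow>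
     open \<Omega> \<and> connected \<Omega> \<and>
     Ck_on 3 \<Omega> V \<and>
     (\<forall>x\<in>\<Omega>. u differentiable (at x)) \<and>
     (\<forall>x\<in>\<Omega>. F x = - gradient V x + u x) \<and>
     (\<forall>x\<in>\<Omega>. divergence u x = 0)"

definition strictly_orthogonal_hhd ::
  "(real ^ 'n::finite) set \<Rightarrow> (real ^ 'n \<Rightarrow> real ^ 'n) \<Rightarrow> (real ^ 'n \<Rightarrow> real) \<Rightarrow> (real ^ 'n \<Rightarrow> real ^ 'n) \<Rightarrow> bool"
  where
  "strictly_orthogonal_hhd \<Omega> F V u \<longleftrightarrow>
     helmholtz_hodge \<Omega> F V u \<and> (\<forall>x\<in>\<Omega>. u x \<bullet> gradient V x = 0)"

lemma gradient_eq_if_GDERIV: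
  fixes f :: "real ^ 'n::finite \<Rightarrow> real"
  assumes "GDERIV f x :> D"
  shows "gradient f x = D"
proof -
  have "frechet_derivative f (at x) = (\<lambda>h. h \<bullet> D)"
    using assms frechet_derivative_at[of f "\<lambda>h. h \<bullet> D" x] by (simp add: gderiv_def)
  then show ?thesis
    by (simp add: vec_eq_iff gradient_def partial_def inner_axis inner_commute)
qed

lemma partial_DERIV:
  fixes f :: "real ^ 'n::finite \<Rightarrow> real"
  assumes "f differentiable (at x)"
  shows "((\<lambda>t. f (x + t *\<^sub>R axis i 1)) has_real_derivative partial i f x) (at 0)"
proof -
  have lin: "linear (frechet_derivative f (at x))"
    using assms by (rule linear_frechet_derivative)
  have f: "(f has_derivative frechet_derivative f (at x)) (at (x + 0 *\<^sub>R axis i 1))"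
    using assms by (simp add: frechet_derivative_works)
  have g: "((\<lambda>t. x + t *\<^sub>R axis i 1) has_derivative (\<lambda>t. t *\<^sub>R axis i 1)) (at (0::real))"
    by (auto intro!: derivative_eq_intros)
  show ?thesis
    using has_derivative_compose[OF g f]
    by (simp add: has_field_derivative_def partial_def linear_cmul[OF lin] mult.commute
        mult_commute_abs)
qed

end

theory Submission imports Defs begin

text \<open>
  Write \<open>p = gradient V\<close>, so that \<open>u x = A *v x + p x\<close>. Strict orthogonality reads
  \<open>(norm (p x))\<^sup>2 = - ((A *v x) \<bullet> p x)\<close>, and Cauchy--Schwarz turns this pointwise identity into the
  growth bound \<open>norm (p x) \<le> norm (A *v x)\<close>. Vanishing divergence of \<open>u\<close> makes the Laplacian of \<open>V\<close>
  constant, so every increment \<open>x \<mapsto> V (x + v) - V x\<close> is harmonic, and by the bound on \<open>p\<close> it grows at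
  most linearly. By a Liouville theorem it is affine (\<open>linear_growth_harmonic_increment\<close>); taking
  gradients, \<open>p (w + v) = p w + p v\<close>. An additive differentiable map is linear, so \<open>p x = P *v x\<close>,
  and \<open>P\<close> is symmetric because the second-order increment
  \<open>V (x + v) - V x - V v + V 0 = x \<bullet> (P *v v)\<close> is symmetric in \<open>x\<close> and \<open>v\<close>
  (\<open>gradient_linear_symmetric\<close>). Orthogonality then says that the quadratic form of the symmetric
  matrix \<open>2 P\<^sup>2 + A\<^sup>T P + P A\<close> vanishes, which is equivalent to the matrix being zero. This last
  equivalence, with the potential \<open>V x = (x \<bullet> (P *v x)) / 2\<close>, also gives the converse.

  The Liouville theorem is proved from the maximum principle alone, without integration. If \<open>f\<close>
  is harmonic, subtract from \<open>f\<close> its mirror image in a coordinate hyperplane through \<open>a\<close>. The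
  difference is harmonic and vanishes on the hyperplane, so on the half ball of radius \<open>R\<close> it lies
  below an explicit quadratic barrier; at distance \<open>t\<close> from \<open>a\<close> along the normal this bounds the
  difference by \<open>2 M (n + 1) t / R\<close>, where \<open>M\<close> bounds \<open>\<bar>f\<bar>\<close> on the ball
  (\<open>harmonic_odd_difference_le\<close>). As \<open>R\<close> tends to infinity, a bounded \<open>f\<close> must be constant; if \<open>f\<close> has
  linear growth, its increments along the coordinate directions are bounded, hence constant. Applying
  this to increments of \<open>V\<close> rather than to its partial derivatives has the advantage that
  they are harmonic at once, since the constant Laplacian of \<open>V\<close> cancels in the difference.
\<close>

section \<open>Functions with a Laplacian\<close>

text \<open>
  The Laplacian is taken in the sense of iterated derivatives along the coordinate lines, since this
  is what the maximum principle consumes and what translations and reflections in coordinate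
  hyperplanes preserve. The witness \<open>G\<close> holds the first derivatives, \<open>H\<close> the second.
\<close>

definition has_laplacian :: "(real ^ 'n::finite \<Rightarrow> real) \<Rightarrow> (real ^ 'n \<Rightarrow> real) \<Rightarrow> bool" where
  "has_laplacian f L \<longleftrightarrow>
     (\<exists>G H. \<forall>x. (\<forall>i. ((\<lambda>t. f (x + t *\<^sub>R axis i 1)) has_real_derivative G i x) (at 0) \<and>
                    ((\<lambda>t. G i (x + t *\<^sub>R axis i 1)) has_real_derivative H i x) (at 0)) \<and>
                L x = (\<Sum>i\<in>UNIV. H i x))"

lemma has_laplacian_diff:
  assumes "has_laplacian f L" "has_laplacian g M"
  shows "has_laplacian (\<lambda>x. f x - g x) (\<lambda>x. L x - M x)"
proof -
  from assms(1) obtain G H where f: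
    "\<And>x i. ((\<lambda>t. f (x + t *\<^sub>R axis i 1)) has_real_derivative G i x) (at 0)"
    "\<And>x i. ((\<lambda>t. G i (x + t *\<^sub>R axis i 1)) has_real_derivative H i x) (at 0)"
    "\<And>x. L x = (\<Sum>i\<in>UNIV. H i x)"
    unfolding has_laplacian_def by metis
  from assms(2) obtain G' H' where g:
    "\<And>x i. ((\<lambda>t. g (x + t *\<^sub>R axis i 1)) has_real_derivative G' i x) (at 0)"
    "\<And>x i. ((\<lambda>t. G' i (x + t *\<^sub>R axis i 1)) has_real_derivative H' i x) (at 0)"
    "\<And>x. M x = (\<Sum>i\<in>UNIV. H' i x)"
    unfolding has_laplacian_def by metis
  show ?thesis
    unfolding has_laplacian_def
    by (rule exI[of _ "\<lambda>i x. G i x - G' i x"], rule exI[of _ "\<lambda>i x. H i x - H' i x"])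
      (auto intro!: DERIV_diff f g simp: f(3) g(3) sum_subtractf)
qed

lemma has_laplacian_translate:
  assumes "has_laplacian f L"
  shows "has_laplacian (\<lambda>x. f (x + v)) (\<lambda>x. L (x + v))"
proof -
  from assms obtain G H where f:
    "\<And>x i. ((\<lambda>t. f (x + t *\<^sub>R axis i 1)) has_real_derivative G i x) (at 0)"
    "\<And>x i. ((\<lambda>t. G i (x + t *\<^sub>R axis i 1)) has_real_derivative H i x) (at 0)"
    "\<And>x. L x = (\<Sum>i\<in>UNIV. H i x)"
    unfolding has_laplacian_def by metis
  have 1: "((\<lambda>t. f (x + t *\<^sub>R axis i 1 + v)) has_real_derivative G i (x + v)) (at 0)" for x i
    using f(1)[of "x + v" i] by (simp add: add_ac)
  have 2: "((\<lambda>t. G i (x + t *\<^sub>R axis i 1 + v)) has_real_derivative H i (x + v)) (at 0)" for x i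
    using f(2)[of i "x + v"] by (simp add: add_ac)
  show ?thesis
    unfolding has_laplacian_def
    by (rule exI[of _ "\<lambda>i x. G i (x + v)"], rule exI[of _ "\<lambda>i x. H i (x + v)"])
      (use 1 2 f(3) in blast)
qed

definition reflect :: "'n \<Rightarrow> real \<Rightarrow> real ^ 'n::finite \<Rightarrow> real ^ 'n" where
  "reflect i s y = y + (2 * (s - y $ i)) *\<^sub>R axis i 1"

lemma reflect_line:
  "reflect i s (x + t *\<^sub>R axis j 1) = reflect i s x + (if j = i then - t else t) *\<^sub>R axis j 1"
  by (auto simp: reflect_def vec_eq_iff axis_def algebra_simps)

lemma norm_plus_axis_power2:
  fixes x :: "real ^ 'n"
  shows "(norm (x + t *\<^sub>R axis i 1))\<^sup>2 = (norm x)\<^sup>2 + 2 * t * x $ i + t\<^sup>2"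
proof -
  have "norm (t *\<^sub>R axis i 1 :: real ^ 'n) ^ 2 = t\<^sup>2" by simp
  then show ?thesis
    using dot_norm[of x "t *\<^sub>R axis i 1"] by (simp add: inner_axis field_simps)
qed

lemma norm_reflect_diff:
  fixes a y :: "real ^ 'n"
  shows "norm (reflect i (a $ i) y - a) = norm (y - a)"
proof -
  have "(norm (reflect i (a $ i) y - a))\<^sup>2 = (norm ((y - a) + (2 * (a $ i - y $ i)) *\<^sub>R axis i 1))\<^sup>2"
    by (simp add: reflect_def algebra_simps)
  also have "\<dots> = (norm (y - a))\<^sup>2"
    unfolding norm_plus_axis_power2 by (simp add: power2_eq_square algebra_simps)
  finally show ?thesis by simp
qed

lemma DERIV_if_mirror:
  assumes "((f :: real \<Rightarrow> real) has_real_derivative D) (at 0)"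
  shows "((\<lambda>t. f (if b then - t else t)) has_real_derivative (if b then - D else D)) (at 0)"
proof (cases b)
  case True
  have "((\<lambda>t. f (- t)) has_real_derivative (D * (-1))) (at 0)"
    by (rule DERIV_chain2[where f = f and g = uminus]) (use assms in \<open>auto intro!: derivative_eq_intros\<close>)
  with True show ?thesis by simp
qed (use assms in simp)

lemma has_laplacian_reflect:
  assumes "has_laplacian f L"
  shows "has_laplacian (\<lambda>x. f (reflect i s x)) (\<lambda>x. L (reflect i s x))"
proof -
  from assms obtain G H where f:
    "\<And>x i. ((\<lambda>t. f (x + t *\<^sub>R axis i 1)) has_real_derivative G i x) (at 0)"
    "\<And>x i. ((\<lambda>t. G i (x + t *\<^sub>R axis i 1)) has_real_derivative H i x) (at 0)"
    "\<And>x. L x = (\<Sum>i\<in>UNIV. H i x)"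
    unfolding has_laplacian_def by metis
  define G' where "G' j x = (if j = i then - G j (reflect i s x) else G j (reflect i s x))" for j x
  have 1: "((\<lambda>t. f (reflect i s (x + t *\<^sub>R axis j 1))) has_real_derivative G' j x) (at 0)" for j x
    unfolding G'_def reflect_line
    by (rule DERIV_if_mirror[where f = "\<lambda>t. f (reflect i s x + t *\<^sub>R axis j 1)"]) (rule f)
  have 2: "((\<lambda>t. G' j (x + t *\<^sub>R axis j 1)) has_real_derivative H j (reflect i s x)) (at 0)" for j x
  proof -
    have "((\<lambda>t. G j (reflect i s x + (if j = i then - t else t) *\<^sub>R axis j 1)) has_real_derivative
            (if j = i then - H j (reflect i s x) else H j (reflect i s x))) (at 0)"
      by (rule DERIV_if_mirror[where f = "\<lambda>t. G j (reflect i s x + t *\<^sub>R axis j 1)"]) (rule f)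
    from this DERIV_minus[OF this] show ?thesis
      unfolding G'_def reflect_line by (cases "j = i") simp_all
  qed
  show ?thesis
    unfolding has_laplacian_def using 1 2 f(3)
    by (intro exI[of _ G'] exI[of _ "\<lambda>j x. H j (reflect i s x)"]) auto
qed

text \<open>
  The family of barriers: choosing \<open>\<gamma>\<close> larger than \<open>n * \<alpha>\<close> makes them strictly superharmonic.
\<close>

lemma has_laplacian_quadratic:
  fixes a :: "real ^ 'n"
  shows "has_laplacian (\<lambda>y. \<alpha> * (norm (y - a))\<^sup>2 + \<beta> * (y $ i - a $ i) - \<gamma> * (y $ i - a $ i)\<^sup>2)
           (\<lambda>y. 2 * (real CARD('n) * \<alpha> - \<gamma>))"
proof -
  define G where "G j x = 2 * \<alpha> * (x $ j - a $ j) +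
    (if j = i then \<beta> - 2 * \<gamma> * (x $ i - a $ i) else 0)" for j and x :: "real ^ 'n"
  define H where "H j = 2 * \<alpha> + (if j = i then - 2 * \<gamma> else 0)" for j
  have shift: "(norm (x + t *\<^sub>R axis j 1 - a))\<^sup>2 = (norm (x - a))\<^sup>2 + 2 * t * (x $ j - a $ j) + t\<^sup>2"
    for x :: "real ^ 'n" and t j
    using norm_plus_axis_power2[of "x - a" t j] by (simp add: algebra_simps)
  show ?thesis
    unfolding has_laplacian_def
  proof (rule exI[of _ G], rule exI[of _ "\<lambda>j x. H j"], intro allI conjI)
    fix x j
    show "((\<lambda>t. \<alpha> * (norm (x + t *\<^sub>R axis j 1 - a))\<^sup>2 + \<beta> * ((x + t *\<^sub>R axis j 1) $ i - a $ i)
         - \<gamma> * ((x + t *\<^sub>R axis j 1) $ i - a $ i)\<^sup>2) has_real_derivative G j x) (at 0)"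
      unfolding shift G_def
      by (cases "j = i") (auto intro!: derivative_eq_intros simp: axis_def algebra_simps)
    show "((\<lambda>t. G j (x + t *\<^sub>R axis j 1)) has_real_derivative H j) (at 0)"
      unfolding G_def H_def
      by (cases "j = i") (auto intro!: derivative_eq_intros simp: axis_def algebra_simps)
    show "2 * (real CARD('n) * \<alpha> - \<gamma>) = (\<Sum>j\<in>UNIV. H j)"
      by (simp add: H_def sum.distrib)
  qed
qed

section \<open>Liouville's theorem by reflection\<close>

lemma second_derivative_nonpos_at_local_max:
  fixes \<phi> :: "real \<Rightarrow> real"
  assumes d: "\<And>t. (\<phi> has_real_derivative \<psi> t) (at t)" and d2: "(\<psi> has_real_derivative c) (at 0)"
    and "\<delta> > 0" and max: "\<And>t. \<bar>t\<bar> < \<delta> \<Longrightarrow> \<phi> t \<le> \<phi> 0"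
  shows "c \<le> 0"
proof (rule ccontr)
  assume "\<not> c \<le> 0"
  then have "c > 0" by simp
  have "\<psi> 0 = 0"
    using DERIV_local_max[OF d \<open>\<delta> > 0\<close>] max by simp
  obtain e where e: "e > 0" "\<And>h. 0 < h \<Longrightarrow> h < e \<Longrightarrow> \<psi> 0 < \<psi> (0 + h)"
    using DERIV_pos_inc_right[OF d2 \<open>c > 0\<close>] by auto
  define t where "t = min \<delta> e / 2"
  have t: "0 < t" "t < \<delta>" "t < e" using \<open>\<delta> > 0\<close> e(1) by (auto simp: t_def)
  have "\<phi> 0 < \<phi> t"
  proof (rule DERIV_pos_imp_increasing_open[OF t(1)])
    fix x assume "0 < x" "x < t"
    then show "\<exists>y. DERIV \<phi> x :> y \<and> y > 0"
      using d e(2)[of x] \<open>\<psi> 0 = 0\<close> t by (intro exI[of _ "\<psi> x"]) auto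
  next
    show "continuous_on {0..t} \<phi>"
      by (meson DERIV_isCont continuous_at_imp_continuous_on d)
  qed
  with max[of t] t show False by simp
qed

text \<open>
  At a maximum in the interior every second derivative along a coordinate line is nonpositive, which
  contradicts a positive Laplacian. Here \<open>K - U\<close> plays the role of the boundary.
\<close>

lemma maximum_principle:
  fixes q :: "real ^ 'n \<Rightarrow> real"
  assumes lap: "has_laplacian q L" and "compact K" "open U" "U \<subseteq> K"
    and cont: "continuous_on K q" and pos: "\<And>x. x \<in> U \<Longrightarrow> L x > 0"
    and bdry: "\<And>x. x \<in> K - U \<Longrightarrow> q x \<le> 0" and "y \<in> K"
  shows "q y \<le> 0"
proof -
  obtain x where x: "x \<in> K" "\<And>z. z \<in> K \<Longrightarrow> q z \<le> q x"
    using continuous_attains_sup[OF \<open>compact K\<close> _ cont] \<open>y \<in> K\<close> by blast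
  have "x \<notin> U"
  proof
    assume "x \<in> U"
    obtain G H where q:
      "\<And>x i. ((\<lambda>t. q (x + t *\<^sub>R axis i 1)) has_real_derivative G i x) (at 0)"
      "\<And>x i. ((\<lambda>t. G i (x + t *\<^sub>R axis i 1)) has_real_derivative H i x) (at 0)"
      "\<And>x. L x = (\<Sum>i\<in>UNIV. H i x)"
      using lap unfolding has_laplacian_def by metis
    obtain \<delta> where \<delta>: "\<delta> > 0" "ball x \<delta> \<subseteq> U"
      using \<open>open U\<close> \<open>x \<in> U\<close> open_contains_ball by blast
    have "H i x \<le> 0" for i
    proof (rule second_derivative_nonpos_at_local_max)
      show "((\<lambda>t. q (x + t *\<^sub>R axis i 1)) has_real_derivative G i (x + t *\<^sub>R axis i 1)) (at t)" for t
      proof -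
        have "((\<lambda>s. q (x + (s + t) *\<^sub>R axis i 1)) has_real_derivative G i (x + t *\<^sub>R axis i 1)) (at 0)"
          using q(1)[where x = "x + t *\<^sub>R axis i 1" and i = i] by (simp add: algebra_simps)
        then show ?thesis
          using DERIV_shift[of "\<lambda>s. q (x + s *\<^sub>R axis i 1)" _ 0 t] by simp
      qed
      show "((\<lambda>t. G i (x + t *\<^sub>R axis i 1)) has_real_derivative H i x) (at 0)" by (rule q)
      show "\<delta> > 0" by fact
      fix t :: real assume "\<bar>t\<bar> < \<delta>"
      then have "x + t *\<^sub>R axis i 1 \<in> K"
        using \<delta>(2) \<open>U \<subseteq> K\<close> by (auto simp: dist_norm subset_iff)
      then show "q (x + t *\<^sub>R axis i 1) \<le> q (x + 0 *\<^sub>R axis i 1)"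
        using x(2) by simp
    qed
    then have "L x \<le> 0" unfolding q(3) by (rule sum_nonpos)
    with pos[OF \<open>x \<in> U\<close>] show False by simp
  qed
  with x(1) bdry have "q x \<le> 0" by blast
  with x(2)[OF \<open>y \<in> K\<close>] show ?thesis by simp
qed

text \<open>
  The function \<open>f\<close> minus its reflection in the hyperplane \<open>y $ i = a $ i\<close> is harmonic, vanishes on
  that hyperplane and is at most \<open>2 * M\<close> on the ball. With \<open>\<tau> = y $ i - a $ i\<close>, the barrier
  \<open>2 M (norm (y - a)\<^sup>2 / R\<^sup>2 + (n + 1) (\<tau> / R - \<tau>\<^sup>2 / R\<^sup>2))\<close> dominates it on the boundary of the half
  ball: it is nonnegative on the flat part and at least \<open>2 * M\<close> on the spherical part. The coefficient
  \<open>n + 1\<close>, rather than \<open>n\<close>, makes the barrier strictly superharmonic, so the maximum principle with a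
  strict inequality suffices.
\<close>

lemma harmonic_odd_difference_le:
  fixes f :: "real ^ 'n \<Rightarrow> real"
  assumes lap: "has_laplacian f (\<lambda>_. 0)" and cont: "continuous_on UNIV f"
    and "M > 0" and bound: "\<And>y. y \<in> cball a R \<Longrightarrow> \<bar>f y\<bar> \<le> M"
    and t: "0 \<le> t" "t \<le> R" and "R > 0"
  shows "f (a + t *\<^sub>R axis i 1) - f (a - t *\<^sub>R axis i 1) \<le> 2 * M * (real CARD('n) + 1) * t / R"
proof -
  define N where "N = real CARD('n) + 1"
  define \<alpha> where "\<alpha> = 2 * M / R\<^sup>2"
  define w where "w y = \<alpha> * (norm (y - a))\<^sup>2 + N * \<alpha> * R * (y $ i - a $ i) - N * \<alpha> * (y $ i - a $ i)\<^sup>2" for y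
  define q where "q y = f y - f (reflect i (a $ i) y) - w y" for y
  define K where "K = cball a R \<inter> {y. a $ i \<le> y $ i}"
  define U where "U = ball a R \<inter> {y. a $ i < y $ i}"
  have "\<alpha> > 0" using \<open>M > 0\<close> \<open>R > 0\<close> by (simp add: \<alpha>_def)
  have "N > 0" by (simp add: N_def)
  have \<alpha>R: "\<alpha> * R\<^sup>2 = 2 * M" using \<open>R > 0\<close> by (simp add: \<alpha>_def)
  let ?y = "a + t *\<^sub>R axis i 1"
  have "q ?y \<le> 0"
  proof (rule maximum_principle)
    show "has_laplacian q (\<lambda>_. 0 - 0 - 2 * (real CARD('n) * \<alpha> - N * \<alpha>))"
      unfolding q_def w_def
      by (intro has_laplacian_diff[where L = "\<lambda>_. 0 - 0"] has_laplacian_diff[where L = "\<lambda>_. 0" and M = "\<lambda>_. 0"] lap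
          has_laplacian_reflect[where L = "\<lambda>_. 0"] has_laplacian_quadratic)
    show "compact K" unfolding K_def
      by (intro compact_Int_closed compact_cball closed_Collect_le continuous_intros)
    show "open U" unfolding U_def
      by (intro open_Int open_ball open_Collect_less continuous_intros)
    show "U \<subseteq> K" by (auto simp: U_def K_def)
    show "continuous_on K q"
      unfolding q_def w_def reflect_def
      by (intro continuous_intros continuous_on_subset[OF cont]
          continuous_on_compose2[OF cont]) auto
    show "0 - 0 - 2 * (real CARD('n) * \<alpha> - N * \<alpha>) > 0"
      using \<open>\<alpha> > 0\<close> by (simp add: N_def algebra_simps)
    show "?y \<in> K" using t by (simp add: K_def dist_norm)
    fix y assume y: "y \<in> K - U"
    define \<tau> where "\<tau> = y $ i - a $ i"
    have \<tau>: "0 \<le> \<tau>" "\<tau> \<le> norm (y - a)" "norm (y - a) \<le> R"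
      using y component_le_norm_cart[of "y - a" i]
      by (auto simp: K_def \<tau>_def dist_norm norm_minus_commute)
    have w: "w y = \<alpha> * (norm (y - a))\<^sup>2 + N * \<alpha> * (\<tau> * (R - \<tau>))"
      by (simp add: w_def \<tau>_def power2_eq_square algebra_simps)
    have nn: "N * \<alpha> * (\<tau> * (R - \<tau>)) \<ge> 0"
      using \<tau> \<open>\<alpha> > 0\<close> \<open>N > 0\<close> by simp
    consider "\<tau> = 0" | "norm (y - a) = R"
      using y \<tau> by (force simp: K_def U_def \<tau>_def dist_norm norm_minus_commute)
    then show "q y \<le> 0"
    proof cases
      case 1
      then have "reflect i (a $ i) y = y" by (simp add: reflect_def \<tau>_def)
      moreover have "\<alpha> * (norm (y - a))\<^sup>2 \<ge> 0" using \<open>\<alpha> > 0\<close> by simp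
      ultimately show ?thesis using w nn by (simp add: q_def)
    next
      case 2
      have "\<bar>f y\<bar> \<le> M" "\<bar>f (reflect i (a $ i) y)\<bar> \<le> M"
        using 2 norm_reflect_diff[of i a y]
        by (auto intro!: bound simp: dist_norm norm_minus_commute)
      then show ?thesis using w nn 2 \<alpha>R by (simp add: q_def)
    qed
  qed
  moreover have "reflect i (a $ i) ?y = a - t *\<^sub>R axis i 1"
    by (auto simp: reflect_def vec_eq_iff axis_def)
  moreover have "w ?y \<le> N * \<alpha> * R * t"
  proof -
    have "\<alpha> * t\<^sup>2 \<le> N * \<alpha> * t\<^sup>2"
      using \<open>\<alpha> > 0\<close> by (simp add: N_def algebra_simps)
    then show ?thesis by (simp add: w_def)
  qed
  moreover have "N * \<alpha> * R * t = 2 * M * N * t / R"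
    using \<open>R > 0\<close> by (simp add: \<alpha>_def power2_eq_square)
  ultimately show ?thesis by (simp add: q_def N_def)
qed

lemma harmonic_odd_difference_abs_le:
  fixes f :: "real ^ 'n \<Rightarrow> real"
  assumes lap: "has_laplacian f (\<lambda>_. 0)" and cont: "continuous_on UNIV f"
    and "M > 0" and bound: "\<And>y. y \<in> cball a R \<Longrightarrow> \<bar>f y\<bar> \<le> M"
    and t: "0 \<le> t" "t \<le> R" and "R > 0"
  shows "\<bar>f (a + t *\<^sub>R axis i 1) - f (a - t *\<^sub>R axis i 1)\<bar> \<le> 2 * M * (real CARD('n) + 1) * t / R"
proof -
  have zero: "has_laplacian (\<lambda>_::real^'n. 0) (\<lambda>_. 0)"
    using has_laplacian_diff[OF lap lap] by simp
  have "has_laplacian (\<lambda>x. - f x) (\<lambda>_. 0)"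
    using has_laplacian_diff[OF zero lap] by simp
  then have "- f (a + t *\<^sub>R axis i 1) - - f (a - t *\<^sub>R axis i 1) \<le> 2 * M * (real CARD('n) + 1) * t / R"
    by (rule harmonic_odd_difference_le)
       (use cont bound t \<open>M > 0\<close> \<open>R > 0\<close> in \<open>auto intro: continuous_intros\<close>)
  moreover have "f (a + t *\<^sub>R axis i 1) - f (a - t *\<^sub>R axis i 1) \<le> 2 * M * (real CARD('n) + 1) * t / R"
    by (rule harmonic_odd_difference_le[OF lap cont \<open>M > 0\<close> bound t \<open>R > 0\<close>])
  ultimately show ?thesis by linarith
qed

text \<open>
  Let \<open>R\<close> tend to infinity in the bound \<open>2 * M * (n + 1) * t / R\<close>: values at points that are symmetric
  about any centre along a coordinate direction agree, and these moves connect all points.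
\<close>

lemma bounded_harmonic_const:
  fixes f :: "real ^ 'n \<Rightarrow> real"
  assumes lap: "has_laplacian f (\<lambda>_. 0)" and cont: "continuous_on UNIV f"
    and bound: "\<And>y. \<bar>f y\<bar> \<le> M"
  shows "f x = f 0"
proof -
  \<comment> \<open>the reflection estimate needs a strictly positive bound\<close>
  define C where "C = M + 1"
  have C: "C > 0" "\<bar>f y\<bar> \<le> C" for y
    using bound[of y] by (auto simp: C_def)
  have sym: "f (a + t *\<^sub>R axis i 1) = f (a - t *\<^sub>R axis i 1)" if "t \<ge> 0" for a t i
  proof -
    have "((\<lambda>R. 2 * C * (real CARD('n) + 1) * t / R) \<longlongrightarrow> 0) at_top"
      by (intro tendsto_divide_0[OF tendsto_const] filterlim_at_top_imp_at_infinity filterlim_ident)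
    moreover have "\<forall>\<^sub>F R in at_top. \<bar>f (a + t *\<^sub>R axis i 1) - f (a - t *\<^sub>R axis i 1)\<bar>
        \<le> 2 * C * (real CARD('n) + 1) * t / R"
      using eventually_gt_at_top[of t]
    proof eventually_elim
      case (elim R)
      with that C show ?case
        by (intro harmonic_odd_difference_abs_le[OF lap cont]) auto
    qed
    ultimately have "\<bar>f (a + t *\<^sub>R axis i 1) - f (a - t *\<^sub>R axis i 1)\<bar> \<le> 0"
      by (intro tendsto_lowerbound) auto
    then show ?thesis by simp
  qed
  \<comment> \<open>the two points are symmetric about their midpoint\<close>
  have step: "f (x + s *\<^sub>R axis i 1) = f x" for x s i
  proof (cases "s \<ge> 0")
    case True
    then show ?thesis
      using sym[of "s/2" "x + (s/2) *\<^sub>R axis i 1" i]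
      by (simp add: add.assoc flip: scaleR_left_distrib)
  next
    case False
    then show ?thesis
      using sym[of "- s/2" "x + (s/2) *\<^sub>R axis i 1" i]
      by (simp add: add.assoc flip: scaleR_left_distrib)
  qed
  have "f (\<Sum>i\<in>S. (x $ i) *\<^sub>R axis i 1) = f 0" for S
    by (induction S rule: infinite_finite_induct) 
      (simp_all add: step add.commute[of "_ *\<^sub>R axis _ 1"])
  from this[of UNIV] show ?thesis by (simp add: basis_expansion flip: scalar_mult_eq_scaleR)
qed

text \<open>
  On \<open>cball a R\<close> the function is at most \<open>C * (1 + norm a + R)\<close>, so the reflection estimate stays
  bounded as \<open>R\<close> tends to infinity, uniformly in \<open>a\<close>. Hence an increment along a coordinate direction
  is a bounded harmonic function and so constant. The displacements \<open>w\<close> with constant increment are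
  closed under addition, which extends the claim from coordinate directions to all \<open>w\<close>. The conclusion
  is the affinity of \<open>f\<close> in the form of a functional equation.
\<close>

lemma linear_growth_harmonic_increment:
  fixes f :: "real ^ 'n \<Rightarrow> real"
  assumes lap: "has_laplacian f (\<lambda>_. 0)" and cont: "continuous_on UNIV f"
    and bound: "\<And>y. \<bar>f y\<bar> \<le> C * (1 + norm y)"
  shows "f (x + w) - f x = f w - f 0"
proof -
  define D where "D = C + 1"
  have "C \<ge> 0" using bound[of 0] by simp
  then have "D > 0" by (simp add: D_def)
  have D: "\<bar>f y\<bar> \<le> D * (1 + norm y)" for y
    using bound[of y] by (auto simp: D_def algebra_simps intro: order_trans)
  define N where "N = real CARD('n) + 1"
  have lip: "\<bar>f (a + t *\<^sub>R axis i 1) - f (a - t *\<^sub>R axis i 1)\<bar> \<le> 2 * D * N * t" if "t \<ge> 0" for a t i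
  proof -
    have "((\<lambda>R. 2 * D * N * t * ((1 + norm a) / R + 1)) \<longlongrightarrow> 2 * D * N * t * (0 + 1)) at_top"
      by (intro tendsto_intros tendsto_divide_0[OF tendsto_const]
          filterlim_at_top_imp_at_infinity filterlim_ident)
    moreover have "\<forall>\<^sub>F R in at_top. \<bar>f (a + t *\<^sub>R axis i 1) - f (a - t *\<^sub>R axis i 1)\<bar>
        \<le> 2 * D * N * t * ((1 + norm a) / R + 1)"
      using eventually_gt_at_top[of t]
    proof eventually_elim
      case (elim R)
      then have "R > 0" using that by simp
      have "\<bar>f (a + t *\<^sub>R axis i 1) - f (a - t *\<^sub>R axis i 1)\<bar>
          \<le> 2 * (D * (1 + norm a + R)) * (real CARD('n) + 1) * t / R"
      proof (rule harmonic_odd_difference_abs_le[OF lap cont])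
        show "0 < D * (1 + norm a + R)"
          using \<open>D > 0\<close> \<open>R > 0\<close> by (intro mult_pos_pos) (auto simp: add_nonneg_pos)
        fix y assume "y \<in> cball a R"
        then have "norm y \<le> norm a + R"
          using norm_triangle_ineq[of a "y - a"] by (simp add: dist_norm norm_minus_commute)
        then have "D * (1 + norm y) \<le> D * (1 + norm a + R)"
          using \<open>D > 0\<close> by simp
        with D[of y] show "\<bar>f y\<bar> \<le> D * (1 + norm a + R)" by linarith
      qed (use that elim in auto)
      also have "\<dots> = 2 * D * N * t * ((1 + norm a) / R + 1)"
        using \<open>R > 0\<close> by (simp add: N_def field_simps)
      finally show ?case .
    qed
    ultimately show ?thesis
      by (intro tendsto_lowerbound) auto
  qed
  have lip': "\<bar>f (x + s *\<^sub>R axis i 1) - f x\<bar> \<le> D * N * \<bar>s\<bar>" for x s i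
  proof (cases "s \<ge> 0")
    case True
    then show ?thesis
      using lip[of "s/2" "x + (s/2) *\<^sub>R axis i 1" i]
      by (simp add: add.assoc flip: scaleR_left_distrib)
  next
    case False
    then show ?thesis
      using lip[of "- s/2" "x + (s/2) *\<^sub>R axis i 1" i]
      by (simp add: add.assoc abs_minus_commute flip: scaleR_left_distrib)
  qed
  have step: "f (x + s *\<^sub>R axis i 1) - f x = f (s *\<^sub>R axis i 1) - f 0" for x s i
  proof -
    have "has_laplacian (\<lambda>x. f (x + s *\<^sub>R axis i 1) - f x) (\<lambda>_. 0)"
      using has_laplacian_diff[OF has_laplacian_translate[OF lap] lap] by simp
    moreover have "continuous_on UNIV (\<lambda>x. f (x + s *\<^sub>R axis i 1) - f x)"
      by (intro continuous_intros cont continuous_on_compose2[OF cont]) auto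
    ultimately show ?thesis
      using bounded_harmonic_const[where f = "\<lambda>x. f (x + s *\<^sub>R axis i 1) - f x" and x = x, OF _ _ lip'] by simp
  qed
  have "\<forall>x. f (x + (\<Sum>i\<in>S. (w $ i) *\<^sub>R axis i 1)) - f x = f (\<Sum>i\<in>S. (w $ i) *\<^sub>R axis i 1) - f 0" for S
  proof (induction S rule: infinite_finite_induct)
    case (insert j S)
    define v where "v = (\<Sum>i\<in>S. (w $ i) *\<^sub>R axis i 1 :: real ^ 'n)"
    have IH: "f (x + v) - f x = f v - f 0" for x
      using insert.IH by (simp add: v_def)
    have "f (x + (v + (w $ j) *\<^sub>R axis j 1)) - f x = f (v + (w $ j) *\<^sub>R axis j 1) - f 0" for x
      using step[of "x + v" "w $ j" j] step[of v "w $ j" j] IH[of x] by (simp add: add.assoc)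
    with insert.hyps show ?case by (simp add: v_def add.commute)
  qed auto
  from this[of UNIV] show ?thesis by (simp add: basis_expansion flip: scalar_mult_eq_scaleR)
qed

section \<open>Potentials with constant Laplacian\<close>

lemma GDERIV_gradient:
  fixes V :: "real ^ 'n \<Rightarrow> real"
  assumes "V differentiable (at x)"
  shows "GDERIV V x :> gradient V x"
proof -
  have lin: "linear (frechet_derivative V (at x))"
    using assms by (rule linear_frechet_derivative)
  have "frechet_derivative V (at x) h = h \<bullet> gradient V x" for h
  proof -
    have "frechet_derivative V (at x) h = frechet_derivative V (at x) (\<Sum>i\<in>UNIV. h $ i *\<^sub>R axis i 1)"
      by (simp add: basis_expansion flip: scalar_mult_eq_scaleR)
    also have "\<dots> = (\<Sum>i\<in>UNIV. h $ i * frechet_derivative V (at x) (axis i 1))"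
      using lin by (simp add: linear_sum linear_cmul)
    finally show ?thesis by (simp add: inner_vec_def gradient_def partial_def)
  qed
  then have "frechet_derivative V (at x) = (\<lambda>h. h \<bullet> gradient V x)" by blast
  with assms show ?thesis by (simp add: gderiv_def frechet_derivative_works)
qed

lemma C2_has_laplacian:
  fixes V :: "real ^ 'n \<Rightarrow> real"
  assumes "Ck_on (Suc (Suc k)) UNIV V"
  shows "has_laplacian V (\<lambda>x. \<Sum>i\<in>UNIV. partial i (partial i V) x)"
  unfolding has_laplacian_def
  using assms
  by (intro exI[of _ "\<lambda>i. partial i V"] exI[of _ "\<lambda>i. partial i (partial i V)"])
     (simp add: partial_DERIV)

text \<open>
  By additivity the derivative at \<open>0\<close> is the derivative everywhere, so subtracting it leaves a function
  with zero derivative.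
\<close>

lemma additive_differentiable_imp_linear:
  fixes f :: "'a::real_normed_vector \<Rightarrow> 'b::real_normed_vector"
  assumes add: "\<And>x y. f (x + y) = f x + f y" and "f differentiable (at 0)"
  shows "linear f"
proof -
  obtain L where L: "(f has_derivative L) (at 0)"
    using assms(2) unfolding differentiable_def by blast
  have f0: "f 0 = 0" using add[of 0 0] by simp
  have bl: "bounded_linear L" using L by (rule has_derivative_bounded_linear)
  then have lin: "linear L" by (rule bounded_linear.linear)
  have der: "(f has_derivative L) (at x)" for x
  proof -
    have shift: "((\<lambda>y. y - x) has_derivative (\<lambda>h. h)) (at x)"
      by (auto intro!: derivative_eq_intros)
    have "((\<lambda>y. f (y - x) + f x) has_derivative (\<lambda>h. L h + 0)) (at x)"
      by (intro has_derivative_add has_derivative_compose[OF shift]) (use L in auto)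
    then show ?thesis by (simp flip: add)
  qed
  have "((\<lambda>x. f x - L x) has_derivative (\<lambda>h. 0)) (at x within UNIV)" for x
    using has_derivative_diff[OF der bounded_linear_imp_has_derivative[OF bl]] by simp
  then have "f x - L x = f 0 - L 0" for x
    using has_derivative_zero_unique[of UNIV "\<lambda>x. f x - L x" x 0] by simp
  then have "f = L" using f0 linear_0[OF lin] by (simp add: fun_eq_iff)
  with lin show ?thesis by simp
qed

lemma increment_le_of_gradient_le:
  fixes V :: "real ^ 'n \<Rightarrow> real"
  assumes diff: "\<And>x. V differentiable (at x)" and "B \<ge> 0"
    and grad: "\<And>x. norm (gradient V x) \<le> B * norm x"
  shows "\<bar>V (x + v) - V x\<bar> \<le> B * (norm x + norm v) * norm v"
proof -
  let ?S = "cball 0 (norm x + norm v) :: (real ^ 'n) set"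
  have "norm (V (x + v) - V x) \<le> B * (norm x + norm v) * norm (x + v - x)"
  proof (rule differentiable_bound[of ?S])
    show "(V has_derivative (\<lambda>h. h \<bullet> gradient V y)) (at y within ?S)" for y
      using GDERIV_gradient[OF diff] by (simp add: gderiv_def has_derivative_at_withinI)
    fix y assume "y \<in> ?S"
    then have "B * norm y \<le> B * (norm x + norm v)"
      using \<open>B \<ge> 0\<close> by (intro mult_left_mono) auto
    then have g: "norm (gradient V y) \<le> B * (norm x + norm v)"
      using grad[of y] by linarith
    show "onorm (\<lambda>h. h \<bullet> gradient V y) \<le> B * (norm x + norm v)"
    proof (rule onorm_le)
      fix h
      have "norm (h \<bullet> gradient V y) \<le> norm h * norm (gradient V y)"
        by (simp add: Cauchy_Schwarz_ineq2)
      also have "\<dots> \<le> norm h * (B * (norm x + norm v))"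
        using g by (intro mult_left_mono) auto
      finally show "norm (h \<bullet> gradient V y) \<le> B * (norm x + norm v) * norm h"
        by (simp add: mult.commute)
    qed
  qed (use norm_triangle_ineq[of x v] in auto)
  then show ?thesis by simp
qed

text \<open>
  The increments of \<open>V\<close> are harmonic because the constant Laplacian cancels, and they grow linearly by
  the mean value inequality. Liouville's theorem then shows that the second-order increments of \<open>V\<close> do
  not depend on the base point; differentiating with respect to the base point gives additivity of the
  gradient.
\<close>

lemma gradient_linear_symmetric:
  fixes V :: "real ^ 'n \<Rightarrow> real"
  assumes C2: "Ck_on (Suc (Suc k)) UNIV V"
    and lap: "\<And>x. (\<Sum>i\<in>UNIV. partial i (partial i V) x) = c"
    and "B \<ge> 0" and grad: "\<And>x. norm (gradient V x) \<le> B * norm x"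
  obtains P :: "real ^ 'n ^ 'n" where "transpose P = P" "\<And>x. gradient V x = P *v x"
proof -
  define p where "p = gradient V"
  have diff: "V differentiable (at x)" for x using C2 by simp
  have V': "(V has_derivative (\<lambda>h. h \<bullet> p x)) (at x)" for x
    using GDERIV_gradient[OF diff] by (simp add: gderiv_def p_def)
  have V_shift': "((\<lambda>x. V (x + v)) has_derivative (\<lambda>h. h \<bullet> p (x + v))) (at x)" for x v
  proof -
    have "((\<lambda>y. y + v) has_derivative (\<lambda>h. h)) (at x)"
      by (auto intro!: derivative_eq_intros)
    from has_derivative_compose[OF this V'] show ?thesis .
  qed
  have cont: "continuous_on UNIV V"
    using diff differentiable_imp_continuous_within continuous_on_eq_continuous_within by blast
  have increment: "V (x + w + v) - V (x + w) - (V (x + v) - V x) = V (w + v) - V w - (V v - V 0)"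
    for x w v
  proof -
    have "has_laplacian (\<lambda>x. V (x + v) - V x) (\<lambda>_. 0)"
      using has_laplacian_diff[OF has_laplacian_translate C2_has_laplacian, OF C2_has_laplacian, OF C2 C2]
      by (simp add: lap)
    moreover have "continuous_on UNIV (\<lambda>x. V (x + v) - V x)"
      by (intro continuous_intros cont continuous_on_compose2[OF cont]) auto
    moreover have "\<bar>V (y + v) - V y\<bar> \<le> (B * (1 + norm v) * norm v) * (1 + norm y)" for y
    proof -
      have "norm y + norm v \<le> (1 + norm v) * (1 + norm y)" by (simp add: algebra_simps)
      then have "B * (norm y + norm v) * norm v \<le> B * ((1 + norm v) * (1 + norm y)) * norm v"
        using \<open>B \<ge> 0\<close> by (intro mult_right_mono mult_left_mono) auto
      then show ?thesis
        using increment_le_of_gradient_le[OF diff \<open>B \<ge> 0\<close> grad, of y v] by (simp add: mult_ac)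
    qed
    ultimately show ?thesis
      using linear_growth_harmonic_increment
        [of "\<lambda>x. V (x + v) - V x" "B * (1 + norm v) * norm v" x w] by simp
  qed
  have p0: "p 0 = 0" using grad[of 0] by (simp add: p_def)
  have add: "p (w + v) = p w + p v" for w v
  proof -
    define F where "F x = V (x + (w + v)) - V (x + w) - (V (x + v) - V x)" for x
    have "(F has_derivative (\<lambda>h. h \<bullet> p (0 + (w + v)) - h \<bullet> p (0 + w) - (h \<bullet> p (0 + v) - h \<bullet> p 0))) (at 0)"
      unfolding F_def by (intro has_derivative_diff V' V_shift')
    moreover have "F = (\<lambda>x. V (w + v) - V w - (V v - V 0))"
      using increment by (simp add: F_def add.assoc fun_eq_iff)
    then have "(F has_derivative (\<lambda>h. 0)) (at 0)" by simp
    ultimately have "(\<lambda>h. h \<bullet> p (0 + (w + v)) - h \<bullet> p (0 + w) - (h \<bullet> p (0 + v) - h \<bullet> p 0)) = (\<lambda>h. 0)"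
      by (rule has_derivative_unique)
    then have "h \<bullet> (p (w + v) - (p w + p v)) = 0" for h
      using p0 by (simp add: fun_eq_iff inner_diff_right inner_add_right algebra_simps)
    from this[of "p (w + v) - (p w + p v)"] show ?thesis by simp
  qed
  have "linear (\<lambda>x. p x $ i)" for i
    using C2 add
    by (intro additive_differentiable_imp_linear) (simp_all add: p_def gradient_def vec_eq_iff)
  then have lin: "linear p"
    by (simp add: linear_iff vec_eq_iff)
  \<comment> \<open>\<open>x \<bullet> p v\<close> is the second-order increment of \<open>V\<close> at \<open>0\<close>, which is symmetric in \<open>x\<close> and \<open>v\<close>\<close>
  have sym: "x \<bullet> p v = v \<bullet> p x" for x v
  proof -
    have affine: "V (x + v) - V x - x \<bullet> p v = V v - V 0" for x v
    proof -
      have "((\<lambda>x. V (x + v) - V x - x \<bullet> p v) has_derivative (\<lambda>h. 0)) (at x within UNIV)" for x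
      proof -
        have "((\<lambda>x. V (x + v) - V x - x \<bullet> p v) has_derivative
               (\<lambda>h. h \<bullet> p (x + v) - h \<bullet> p x - h \<bullet> p v)) (at x)"
          by (intro has_derivative_diff V' V_shift') (auto intro!: derivative_eq_intros)
        then show ?thesis by (simp add: add inner_add_right)
      qed
      from has_derivative_zero_unique[OF convex_UNIV this, of x 0] show ?thesis by simp
    qed
    from affine[of x v] affine[of v x] show ?thesis by (simp add: add.commute)
  qed
  have "transpose (matrix p) = matrix p"
    using sym[of "axis _ 1" "axis _ 1"]
    by (simp add: matrix_def transpose_def vec_eq_iff inner_axis')
  moreover have "gradient V x = matrix p *v x" for x
    using fun_cong[OF matrix_vector_mul(2)[OF lin], of x] by (simp add: p_def)
  ultimately show thesis by (rule that)
qed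

section \<open>The matrix equation\<close>

lemma inner_transpose_mult:
  fixes M :: "real ^ 'n ^ 'n"
  shows "x \<bullet> (transpose M *v y) = (M *v x) \<bullet> y"
  by (metis dot_lmul_matrix inner_commute transpose_matrix_vector)

lemma transpose_plus: "transpose (M + N) = transpose M + transpose N" for M N :: "real ^ 'n ^ 'm"
  by (simp add: transpose_def vec_eq_iff)

text \<open>Polarisation: expanding the form at \<open>x + y\<close> leaves twice the mixed term \<open>x \<bullet> (S *v y)\<close>.\<close>

lemma symmetric_zero_if_quadratic_form_zero:
  fixes S :: "real ^ 'n ^ 'n"
  assumes sym: "transpose S = S" and zero: "\<And>x. x \<bullet> (S *v x) = 0"
  shows "S = 0"
proof -
  have "x \<bullet> (S *v y) = 0" for x y
  proof -
    have "x \<bullet> (S *v y) = y \<bullet> (S *v x)"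
      using inner_transpose_mult[of x S y] sym by (simp add: inner_commute)
    moreover have "(x + y) \<bullet> (S *v (x + y)) = 0" by (rule zero)
    ultimately show ?thesis
      using zero[of x] zero[of y]
      by (simp add: matrix_vector_right_distrib inner_add_left inner_add_right)
  qed
  then have "S *v y = 0" for y by (metis inner_eq_zero_iff)
  then show ?thesis by (simp add: matrix_eq)
qed

text \<open>
  This is the bridge between the two sides of the theorem: for linear fields, pointwise orthogonality
  of \<open>u\<close> and \<open>gradient V\<close> is the vanishing of the quadratic form of the matrix in the equation for \<open>P\<close>.
\<close>

lemma orthogonality_quadratic_form:
  fixes A P :: "real ^ 'n ^ 'n"
  assumes "transpose P = P"
  shows "x \<bullet> ((2 *\<^sub>R (P ** P) + transpose A ** P + P ** A) *v x) = 2 * (((A + P) *v x) \<bullet> (P *v x))"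
proof -
  have P: "x \<bullet> (P *v y) = (P *v x) \<bullet> y" for y
    using inner_transpose_mult[of x P y] assms by simp
  have "x \<bullet> ((2 *\<^sub>R (P ** P) + transpose A ** P + P ** A) *v x)
      = 2 * (x \<bullet> (P *v (P *v x))) + x \<bullet> (transpose A *v (P *v x)) + x \<bullet> (P *v (A *v x))"
    by (simp add: matrix_vector_mult_add_rdistrib scaleR_matrix_vector_assoc[symmetric]
        matrix_vector_mul_assoc inner_add_right)
  also have "\<dots> = 2 * (((A + P) *v x) \<bullet> (P *v x))"
    by (simp only: P inner_transpose_mult)
       (simp add: matrix_vector_mult_add_rdistrib inner_add_left inner_commute[of "P *v x" "A *v x"])
  finally show ?thesis .
qed

section \<open>Orthogonal decompositions of linear fields\<close>

lemma partial_linear: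
  fixes f :: "real ^ 'n \<Rightarrow> real"
  assumes "linear f"
  shows "partial i f x = f (axis i 1)"
  unfolding partial_def
  by (simp add: frechet_derivative_at[OF linear_imp_has_derivative[OF assms], symmetric])

lemma linear_mult_component: "linear (\<lambda>x. (M *v x) $ i)" for M :: "real ^ 'n ^ 'm"
  by (simp add: linear_iff matrix_vector_right_distrib matrix_vector_mult_scaleR)

lemma divergence_matrix:
  fixes M :: "real ^ 'n ^ 'n"
  shows "divergence (\<lambda>x. M *v x) x = trace M"
  by (simp add: divergence_def partial_linear[OF linear_mult_component] trace_def
      matrix_vector_mult_basis column_def)

lemma partial_add:
  assumes "f differentiable (at x)" "g differentiable (at x)"
  shows "partial i (\<lambda>y. f y + g y) x = partial i f x + partial i g x"
proof -
  have "((\<lambda>y. f y + g y) has_derivative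
      (\<lambda>h. frechet_derivative f (at x) h + frechet_derivative g (at x) h)) (at x)"
    using assms by (intro has_derivative_add) (simp_all add: frechet_derivative_works)
  from frechet_derivative_at[OF this] show ?thesis by (simp add: partial_def fun_eq_iff)
qed

lemma GDERIV_quadratic_form:
  fixes P :: "real ^ 'n ^ 'n"
  assumes "transpose P = P"
  shows "GDERIV (\<lambda>x. (x \<bullet> (P *v x)) / 2) x :> P *v x"
proof -
  have "((\<lambda>x. (x \<bullet> (P *v x)) / 2) has_derivative (\<lambda>h. (x \<bullet> (P *v h) + h \<bullet> (P *v x)) / 2)) (at x)"
    by (auto intro!: derivative_eq_intros linear_imp_has_derivative)
  moreover have "(x \<bullet> (P *v h) + h \<bullet> (P *v x)) / 2 = h \<bullet> (P *v x)" for h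
    using inner_transpose_mult[of x P h] assms by (simp add: inner_commute)
  ultimately show ?thesis by (simp add: gderiv_def)
qed

lemma Ck_on_const: "Ck_on k \<Omega> (\<lambda>_. c)"
  by (induction k arbitrary: c) (simp_all add: partial_def[abs_def])

lemma Ck_on_if_gradient_matrix:
  fixes V :: "real ^ 'n \<Rightarrow> real"
  assumes diff: "\<And>x. V differentiable (at x)" and grad: "\<And>x. gradient V x = P *v x"
  shows "Ck_on (Suc (Suc k)) UNIV V"
proof -
  have "partial i V = (\<lambda>x. (P *v x) $ i)" for i
    using grad by (simp add: fun_eq_iff gradient_def vec_eq_iff)
  moreover have "partial j (\<lambda>x. (P *v x) $ i) = (\<lambda>_. (P *v axis j 1) $ i)" for i j
    by (simp add: fun_eq_iff partial_linear[OF linear_mult_component])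
  ultimately show ?thesis
    using diff by (simp add: Ck_on_const linear_imp_differentiable[OF linear_mult_component])
qed

text \<open>
  Orthogonality is used twice: first, through Cauchy--Schwarz, to bound \<open>gradient V\<close> by the linear
  field, which makes Liouville's theorem applicable, and then, once the gradient is known to be linear,
  to obtain the matrix equation.
\<close>

lemma strictly_orthogonal_imp_matrix:
  fixes A :: "real ^ 'n ^ 'n" and V :: "real ^ 'n \<Rightarrow> real"
  assumes hhd: "strictly_orthogonal_hhd UNIV (\<lambda>x. A *v x) V u"
  obtains P :: "real ^ 'n ^ 'n" where "transpose P = P" "trace P = - trace A"
    "2 *\<^sub>R (P ** P) + transpose A ** P + P ** A = 0"
    "\<And>x. gradient V x = P *v x" "\<And>x. u x = (A + P) *v x"
proof -
  have C2: "Ck_on (Suc (Suc 1)) UNIV V"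
    and div: "\<And>x. divergence u x = 0" and orth: "\<And>x. u x \<bullet> gradient V x = 0"
    and dec: "\<And>x. A *v x = - gradient V x + u x"
    using hhd by (auto simp: strictly_orthogonal_hhd_def helmholtz_hodge_def numeral_3_eq_3)
  have u: "u x = A *v x + gradient V x" for x using dec[of x] by simp
  have lap: "(\<Sum>i\<in>UNIV. partial i (partial i V) x) = - trace A" for x
  proof -
    have "divergence u x = divergence (\<lambda>x. A *v x) x + (\<Sum>i\<in>UNIV. partial i (partial i V) x)"
      unfolding divergence_def u[abs_def] sum.distrib[symmetric]
      using C2
      by (simp add: gradient_def partial_add linear_imp_differentiable[OF linear_mult_component])
    then show ?thesis using div[of x] by (simp add: divergence_matrix)
  qed
  obtain B where B: "B > 0" "\<And>x. norm (A *v x) \<le> B * norm x"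
    using linear_bounded_pos[OF matrix_vector_mul_linear[of A]] by blast
  have grad: "norm (gradient V x) \<le> B * norm x" for x
  proof -
    have "(norm (gradient V x))\<^sup>2 = - ((A *v x) \<bullet> gradient V x)"
      using orth[of x] by (simp add: u inner_add_left power2_norm_eq_inner)
    also have "\<dots> \<le> norm (A *v x) * norm (gradient V x)"
      using norm_cauchy_schwarz[of "- (A *v x)" "gradient V x"] by simp
    finally have "norm (gradient V x) \<le> norm (A *v x)"
      by (cases "gradient V x = 0") (simp_all add: power2_eq_square)
    with B(2)[of x] show ?thesis by linarith
  qed
  from B(1) have "B \<ge> 0" by simp
  obtain P where P: "transpose P = P" "\<And>x. gradient V x = P *v x"
    using gradient_linear_symmetric[OF C2 lap \<open>B \<ge> 0\<close> grad] by blast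
  have uP: "u x = (A + P) *v x" for x
    by (simp add: u P(2) matrix_vector_mult_add_rdistrib)
  show thesis
  proof (rule that[OF P(1) _ _ P(2) uP])
    have "divergence (\<lambda>x. (A + P) *v x) 0 = 0"
      using div[of 0] by (simp add: uP[abs_def])
    then show "trace P = - trace A"
      by (simp add: divergence_matrix trace_add)
    show "2 *\<^sub>R (P ** P) + transpose A ** P + P ** A = 0" (is "?S = 0")
    proof (rule symmetric_zero_if_quadratic_form_zero)
      show "transpose ?S = ?S"
        using P(1)
        by (simp add: transpose_plus transpose_scalar matrix_transpose_mul add_ac)
      show "x \<bullet> (?S *v x) = 0" for x
        using orth[of x] by (simp only: orthogonality_quadratic_form[OF P(1)]) (simp add: uP P(2))
    qed
  qed
qed

lemma matrix_imp_strictly_orthogonal: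
  fixes A P :: "real ^ 'n ^ 'n"
  assumes sym: "transpose P = P" and tr: "trace P = - trace A"
    and eq: "2 *\<^sub>R (P ** P) + transpose A ** P + P ** A = 0"
  obtains V where "\<And>x. gradient V x = P *v x"
    "strictly_orthogonal_hhd UNIV (\<lambda>x. A *v x) V (\<lambda>x. (A + P) *v x)"
proof
  let ?V = "\<lambda>x. (x \<bullet> (P *v x)) / 2"
  show grad: "gradient ?V x = P *v x" for x
    by (rule gradient_eq_if_GDERIV[OF GDERIV_quadratic_form[OF sym]])
  have "?V differentiable (at x)" for x
    using GDERIV_quadratic_form[OF sym] unfolding gderiv_def differentiable_def by blast
  then have "Ck_on 3 UNIV ?V"
    unfolding numeral_3_eq_3 by (rule Ck_on_if_gradient_matrix) (rule grad)
  moreover have "divergence (\<lambda>x. (A + P) *v x) x = 0" for x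
    by (simp add: divergence_matrix trace_add tr)
  moreover have "((A + P) *v x) \<bullet> (P *v x) = 0" for x
    using orthogonality_quadratic_form[OF sym, of x A] by (simp add: eq)
  moreover have "(\<lambda>x. (A + P) *v x) differentiable (at x)" for x
    by (rule linear_imp_differentiable) simp
  ultimately show "strictly_orthogonal_hhd UNIV (\<lambda>x. A *v x) ?V (\<lambda>x. (A + P) *v x)"
    unfolding strictly_orthogonal_hhd_def helmholtz_hodge_def grad
    by (auto simp only: open_UNIV connected_UNIV ball_UNIV UNIV_I) (simp add: matrix_vector_mult_add_rdistrib)
qed

theorem theorem1:
  fixes A :: "real ^ 'n ^ 'n"
  shows "(\<forall>(V :: real ^ 'n \<Rightarrow> real) (u :: real ^ 'n \<Rightarrow> real ^ 'n).
            strictly_orthogonal_hhd UNIV (\<lambda>x. A *v x) V u \<longrightarrow>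
            (\<exists>P H :: real ^ 'n ^ 'n.
               transpose P = P \<and> trace P = - trace A \<and>
               2 *\<^sub>R (P ** P) + transpose A ** P + P ** A = 0 \<and>
               H = A + P \<and>
               (\<forall>x. gradient V x = P *v x) \<and> (\<forall>x. u x = H *v x)))
       \<and> (\<forall>P H :: real ^ 'n ^ 'n.
            transpose P = P \<longrightarrow> trace P = - trace A \<longrightarrow>
            2 *\<^sub>R (P ** P) + transpose A ** P + P ** A = 0 \<longrightarrow>
            H = A + P \<longrightarrow>
            A = - P + H \<and>
            (\<exists>V :: real ^ 'n \<Rightarrow> real.
               (\<forall>x. gradient V x = P *v x) \<and>
               strictly_orthogonal_hhd UNIV (\<lambda>x. A *v x) V (\<lambda>x. H *v x)))"
proof (intro conjI allI impI)
  fix V :: "real ^ 'n \<Rightarrow> real" and u :: "real ^ 'n \<Rightarrow> real ^ 'n"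
  assume "strictly_orthogonal_hhd UNIV (\<lambda>x. A *v x) V u"
  then show "\<exists>P H :: real ^ 'n ^ 'n.
      transpose P = P \<and> trace P = - trace A \<and>
      2 *\<^sub>R (P ** P) + transpose A ** P + P ** A = 0 \<and>
      H = A + P \<and> (\<forall>x. gradient V x = P *v x) \<and> (\<forall>x. u x = H *v x)"
    by (rule strictly_orthogonal_imp_matrix) blast
next
  fix P H :: "real ^ 'n ^ 'n"
  assume P: "transpose P = P" "trace P = - trace A"
    "2 *\<^sub>R (P ** P) + transpose A ** P + P ** A = 0" and H: "H = A + P"
  then show "A = - P + H" by simp
  show "\<exists>V :: real ^ 'n \<Rightarrow> real.
      (\<forall>x. gradient V x = P *v x) \<and>
      strictly_orthogonal_hhd UNIV (\<lambda>x. A *v x) V (\<lambda>x. H *v x)"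
    using matrix_imp_strictly_orthogonal[OF P] unfolding H by metis
qed

end
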